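(* Let $a\ge 2$ be a fixed integer. Then $$\omega(k,a)\le\frac{k\,a^{k/2}}{e}\bigl(1+o(1)\bigr)\qquad (k\to\infty),$$ where the $o(1)$ term may be taken to be $\frac{2\log k}{k}$; that is, for all sufficiently large positive integers $k$ (depending on $a$), $\omega(k,a)\le\frac{k\,a^{k/2}}{e}\left(1+\frac{2\log k}{k}\right)$.
   Context: Let $\mathcal A=\{1,2,\ldots,a\}$. A submatrix of a matrix is obtained by selecting some rows and some columns (not necessarily contiguous), keeping their order. An omnimosaic $O(n,k,a)$ is an $n\times n$ matrix with entries in $\mathcal A$ that contains, as a submatrix, each of the $a^{k^2}$ $k\times k$ matrices over $\mathcal A$. For positive integers $k,a$, $\omega(k,a)$ denotes the smallest $n$ for which an $O(n,k,a)$ omnimosaic exists. Here $\log$ is the natural logarithm and $e$ is its base. *)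

theory Defs
  imports
    Complex_Main
    "HOL-Library.Landau_Symbols"
    "Jordan_Normal_Form.Matrix"
    "Jordan_Normal_Form.DL_Submatrix"
begin

definition square_mats :: "nat \<Rightarrow> nat \<Rightarrow> nat mat set" where
  "square_mats n a = {A \<in> carrier_mat n n. elements_mat A \<subseteq> {1..a}}"

definition is_submatrix :: "'a mat \<Rightarrow> 'a mat \<Rightarrow> bool" where
  "is_submatrix B A \<longleftrightarrow>
     (\<exists>I J. I \<subseteq> {..<dim_row A} \<and> J \<subseteq> {..<dim_col A} \<and> B = submatrix A I J)"

definition omnimosaic :: "nat \<Rightarrow> nat \<Rightarrow> nat \<Rightarrow> nat mat \<Rightarrow> bool" where
  "omnimosaic n k a M \<longleftrightarrow>
     M \<in> square_mats n a \<and> (\<forall>B \<in> square_mats k a. is_submatrix B M)"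

text \<open>The minimum ranges over a nonempty set whenever \<open>k\<close> and \<open>a\<close> are positive; see
  \<open>omnimosaic_exists\<close> below.\<close>

definition omega :: "nat \<Rightarrow> nat \<Rightarrow> nat" where
  "omega k a = (LEAST n. \<exists>M. omnimosaic n k a M)"

lemma finite_square_mats: "finite (square_mats k a)"
proof (rule finite_subset)
  let ?D = "{..<k} \<times> {..<k}"
  show "square_mats k a \<subseteq> (\<lambda>f. mat k k f) ` (PiE ?D (\<lambda>_. {1..a}))"
  proof
    fix A assume A: "A \<in> square_mats k a"
    then have c: "A \<in> carrier_mat k k" and e: "elements_mat A \<subseteq> {1..a}"
      by (auto simp: square_mats_def)
    have "A = mat k k (restrict (\<lambda>p. A $$ p) ?D)"
      using c by (intro eq_matI) auto
    moreover have "restrict (\<lambda>p. A $$ p) ?D \<in> PiE ?D (\<lambda>_. {1..a})"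
    proof (rule restrict_PiE_iff[THEN iffD2], rule ballI)
      fix p assume "p \<in> ?D"
      then obtain i j where "p = (i, j)" "i < k" "j < k" by auto
      then have "A $$ p \<in> elements_mat A"
        using elements_matI[OF c \<open>i < k\<close> \<open>j < k\<close> refl] by simp
      with e show "A $$ p \<in> {1..a}" by (rule subsetD)
    qed
    ultimately show "A \<in> (\<lambda>f. mat k k f) ` (PiE ?D (\<lambda>_. {1..a}))" by blast
  qed
  show "finite ((\<lambda>f. mat k k f) ` (PiE ?D (\<lambda>_. {1..a})))"
    by (intro finite_imageI finite_PiE) auto
qed

lemma pick_interval: "i < k \<Longrightarrow> pick {s..<s + k} i = s + i"
proof (induction i)
  case 0
  then show ?case by (simp, intro Least_equality) simp_all
next
  case (Suc i)
  then have "pick {s..<s + k} i = s + i" by simp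
  with Suc.prems show ?case
    by (simp only: pick.simps, intro Least_equality) simp_all
qed

lemma omnimosaic_exists:
  assumes "k \<ge> 1" "a \<ge> 1"
  shows "\<exists>n M. omnimosaic n k a M"
proof -
  obtain Bs where Bs: "set Bs = square_mats k a"
    using finite_list[OF finite_square_mats] by blast
  define n where "n = length Bs * k"
  define M where "M = mat n n (\<lambda>(i, j).
    if i div k = j div k then Bs ! (i div k) $$ (i mod k, j mod k) else (1::nat))"
  have el: "Bs ! b $$ (i, j) \<in> {1..a}" if "b < length Bs" "i < k" "j < k" for b i j
  proof -
    have "Bs ! b \<in> square_mats k a" using Bs that(1) nth_mem by blast
    then show ?thesis using elements_matI[OF _ that(2,3) refl, of "Bs ! b"]
      unfolding square_mats_def by blast
  qed
  have "M \<in> square_mats n a"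
  proof -
    have "elements_mat M \<subseteq> {1..a}"
    proof
      fix x assume "x \<in> elements_mat M"
      then obtain i j where "i < dim_row M" "j < dim_col M" "x = M $$ (i, j)"
        using elements_matD by blast
      then have ij: "i < n" "j < n" "x = M $$ (i, j)"
        by (simp_all only: M_def dim_row_mat dim_col_mat)
      have "i div k < length Bs"
        using ij(1) assms by (simp add: n_def less_mult_imp_div_less)
      then show "x \<in> {1..a}"
        using ij(1,2) assms el[of "i div k" "i mod k" "j mod k"]
        by (cases "i div k = j div k") (simp_all add: ij(3) M_def)
    qed
    then show ?thesis by (simp add: square_mats_def M_def)
  qed
  moreover have "is_submatrix B M" if "B \<in> square_mats k a" for B
  proof -
    have "B \<in> set Bs" using that Bs by simp
    then obtain b where b: "b < length Bs" "Bs ! b = B" by (auto simp only: in_set_conv_nth)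
    have c: "B \<in> carrier_mat k k" using that by (simp add: square_mats_def)
    let ?I = "{b * k..<b * k + k}"
    have "Suc b * k \<le> n" unfolding n_def using b(1) by (intro mult_le_mono1) simp
    then have le: "b * k + k \<le> n" by simp
    have "{i. i < n \<and> i \<in> ?I} = ?I" using le by auto
    then have card: "card {i. i < n \<and> i \<in> ?I} = k" by simp
    have dims: "dim_row M = n" "dim_col M = n" by (simp_all add: M_def)
    have "B = submatrix M ?I ?I"
    proof (rule eq_matI)
      fix i j assume "i < dim_row (submatrix M ?I ?I)" "j < dim_col (submatrix M ?I ?I)"
      then have ij: "i < k" "j < k" by (simp_all only: dim_submatrix dims card)
      have "submatrix M ?I ?I $$ (i, j) = M $$ (b * k + i, b * k + j)"
        using submatrix_index[of i M ?I j ?I] ij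
        by (simp only: dims card pick_interval)
      also have "\<dots> = B $$ (i, j)" using ij le b by (simp add: M_def)
      finally show "B $$ (i, j) = submatrix M ?I ?I $$ (i, j)" by simp
    qed (use c in \<open>simp_all only: dim_submatrix dims card carrier_matD\<close>)
    moreover have "?I \<subseteq> {..<n}" using le by auto
    ultimately show ?thesis unfolding is_submatrix_def dims by blast
  qed
  ultimately have "omnimosaic n k a M" by (simp add: omnimosaic_def)
  then show ?thesis by blast
qed

end

theory Submission
  imports
    Defs
    "HOL-Analysis.Harmonic_Numbers"
    "HOL-Real_Asymp.Real_Asymp"
begin

text \<open>
  Fill an \<open>n \<times> n\<close> matrix with independent uniform entries from \<open>{1..a}\<close>, where \<open>n\<close> is the integer
  part of the claimed bound, and fix a \<open>k \<times> k\<close> matrix \<open>B\<close>. A position (a choice of \<open>k\<close> rows and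
  \<open>k\<close> columns) carries \<open>B\<close> with probability \<open>a ^ (- k\<^sup>2)\<close>, so the expected number of copies of \<open>B\<close> is
  \<open>\<mu> = (n choose k)\<^sup>2 / a ^ k\<^sup>2\<close>. By Stirling's formula, \<open>n choose k\<close> is about
  \<open>(e n / k) ^ k / sqrt (2 \<pi> k)\<close>. With \<open>e n / k \<approx> a powr (k / 2) * (1 + 2 * ln k / k)\<close> and
  \<open>(1 + 2 * ln k / k) ^ (2 * k) \<approx> k ^ 4\<close> this makes \<open>\<mu>\<close> of order \<open>k ^ 3\<close>.

  If copies at different positions were independent, \<open>B\<close> would be missed with probability about
  \<open>exp (- \<mu>)\<close>, far below \<open>a ^ (- k\<^sup>2) = exp (- k\<^sup>2 * ln a)\<close>, and a union bound over the \<open>a ^ k\<^sup>2\<close>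
  matrices \<open>B\<close> would leave a matrix that misses none of them. Copies at positions that share a cell
  are dependent, and for a general \<open>B\<close> they are not monotone events, so the Harris inequality
  does not apply. Instead, \<open>card_avoid_le\<close> proves that the probability of a miss is at most
  \<open>(1 - a ^ (- k\<^sup>2) / 2)\<close> to the number of positions, hence at most \<open>exp (- \<mu> / 2)\<close>, by an induction
  in the style of the Lovasz local lemma. Its only requirement is that, given a copy at one position,
  the expected number of copies at the other positions that meet it is at most \<open>1/4\<close>.

  That expectation is in fact exponentially small. There are at most
  \<open>(k choose x) (n choose x) (k choose y) (n choose y)\<close> positions that replace \<open>x\<close> of the rows and
  \<open>y\<close> of the columns, and each of them adds at most \<open>a ^ ((k - x) (k - y) - k\<^sup>2)\<close>. The
  product of \<open>k choose x\<close> and \<open>n choose x\<close> is at most \<open>a powr (k x / 2)\<close> times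
  \<open>k ^ (2 + 2 * min x (k - x))\<close>, so the exponent of \<open>a\<close> becomes
  \<open>- (x (k - y) + y (k - x)) / 2\<close>. By \<open>overlap_exponent\<close> this is at most
  \<open>- k / 8\<close> times \<open>min x (k - x) + min y (k - y)\<close>, enough to absorb the
  powers of \<open>k\<close>. What remains (\<open>overlap_sum_le\<close>) is at most
  \<open>k ^ 8 * a powr (- k / 8)\<close>.
\<close>

section \<open>Avoiding patterns that rarely overlap\<close>

lemma card_agree_insert:
  fixes A :: "'b set"
  assumes fin: "finite C" "finite A" and x: "x \<in> C" and c: "c \<in> A"
    and sub: "D \<subseteq> C \<rightarrow>\<^sub>E A"
    and inv: "\<And>f b. f \<in> D \<Longrightarrow> b \<in> A \<Longrightarrow> f(x := b) \<in> D"
  shows "card A * card {f \<in> D. f x = c} = card D"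
proof -
  have finD: "finite D" using sub fin by (meson finite_PiE finite_subset)
  have val: "f x \<in> A" if "f \<in> D" for f using that sub x by auto
  have bij: "card {f \<in> D. f x = b} = card {f \<in> D. f x = c}" if "b \<in> A" for b
    by (rule bij_betw_same_card[OF bij_betwI[where f = "\<lambda>f. f(x := c)" and g = "\<lambda>f. f(x := b)"]])
      (use that c inv in \<open>auto simp: fun_upd_idem\<close>)
  have "D = (\<Union>b\<in>A. {f \<in> D. f x = b})" using val by auto
  then have "card D = (\<Sum>b\<in>A. card {f \<in> D. f x = b})"
    by (subst card_UN_disjoint[symmetric]) (use fin finD in auto)
  also have "\<dots> = (\<Sum>b\<in>A. card {f \<in> D. f x = c})" using bij by (intro sum.cong) auto
  finally show ?thesis by simp
qed

text \<open>Independence in counting form: prescribing the values on \<open>U\<close> divides the size of \<open>D\<close> by exactly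
  \<open>card A\<close> for each cell, because membership in \<open>D\<close> does not depend on the cells in \<open>U\<close>.\<close>

lemma card_agree:
  fixes A :: "'b set"
  assumes fin: "finite C" "finite A" and U: "U \<subseteq> C" and g: "\<And>x. x \<in> U \<Longrightarrow> g x \<in> A"
    and sub: "D \<subseteq> C \<rightarrow>\<^sub>E A"
    and inv: "\<And>f x b. f \<in> D \<Longrightarrow> x \<in> U \<Longrightarrow> b \<in> A \<Longrightarrow> f(x := b) \<in> D"
  shows "card A ^ card U * card {f \<in> D. \<forall>x\<in>U. f x = g x} = card D"
proof -
  have "finite U" using U fin finite_subset by blast
  then show ?thesis using U g inv
  proof (induction U rule: finite_induct)
    case empty
    then show ?case by simp
  next
    case (insert x U)
    let ?D = "{f \<in> D. \<forall>x\<in>U. f x = g x}"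
    have "card A * card {f \<in> ?D. f x = g x} = card ?D"
    proof (rule card_agree_insert[OF fin])
      fix f b assume f: "f \<in> ?D" and b: "b \<in> A"
      have "f(x := b) \<in> D" using insert.prems(3)[of f x b] f b by (simp add: fun_upd_def)
      then show "f(x := b) \<in> ?D" using f insert.hyps(2) by auto
    qed (use insert.prems sub in auto)
    moreover have "{f \<in> ?D. f x = g x} = {f \<in> D. \<forall>x\<in>insert x U. f x = g x}" by auto
    moreover have "card A ^ card U * card ?D = card D"
      using insert.prems by (intro insert.IH) auto
    moreover have "card A ^ card (insert x U) = card A ^ card U * card A" using insert.hyps by simp
    ultimately show ?case by (simp only: mult.assoc)
  qed
qed

text \<open>Uniformly random fillings of the cells \<open>C\<close> with letters from \<open>A\<close>, and patterns that each prescribe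
  \<open>m\<close> cells. Two patterns that agree on their common cells occur together with probability
  \<open>card A ^ card (U i \<inter> U j) / card A ^ (2 * m)\<close>, so \<open>overlap\<close> bounds by \<open>1/4\<close> the
  expected number of other patterns meeting \<open>U i\<close> that occur, given that pattern \<open>i\<close> does. Since each summand is at
  least \<open>1 / card A ^ m\<close>, it also bounds the number of patterns that meet \<open>U i\<close>.\<close>

locale pattern_family =
  fixes C :: "'c set" and A :: "'b set" and I :: "'i set"
    and U :: "'i \<Rightarrow> 'c set" and g :: "'i \<Rightarrow> 'c \<Rightarrow> 'b" and m :: nat
  assumes finC: "finite C" and finA: "finite A" and neA: "A \<noteq> {}" and finI: "finite I"
    and U_sub: "i \<in> I \<Longrightarrow> U i \<subseteq> C" and U_card: "i \<in> I \<Longrightarrow> card (U i) = m"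
    and g_in: "i \<in> I \<Longrightarrow> x \<in> U i \<Longrightarrow> g i x \<in> A"
    and overlap: "i \<in> I \<Longrightarrow>
      (\<Sum>j | j \<in> I \<and> j \<noteq> i \<and> U i \<inter> U j \<noteq> {}. real (card A) ^ card (U i \<inter> U j) / real (card A) ^ m) \<le> 1/4"
begin

definition occ :: "'i \<Rightarrow> ('c \<Rightarrow> 'b) set" where
  "occ i = {f. \<forall>x\<in>U i. f x = g i x}"

definition avoid :: "'i set \<Rightarrow> ('c \<Rightarrow> 'b) set" where
  "avoid S = {f \<in> C \<rightarrow>\<^sub>E A. \<forall>j\<in>S. f \<notin> occ j}"

definition occ_prob :: real where "occ_prob = 1 / real (card A) ^ m"

lemma card_A_ge_1: "real (card A) \<ge> 1"
  using finA neA by (simp add: Suc_leI card_gt_0_iff)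

lemma occ_prob_pos: "occ_prob > 0"
  using card_A_ge_1 by (simp add: occ_prob_def)

lemma finite_avoid: "finite (avoid S)"
  unfolding avoid_def using finC finA by (simp add: finite_PiE)

lemma avoid_antimono: "S \<subseteq> T \<Longrightarrow> avoid T \<subseteq> avoid S"
  by (auto simp: avoid_def)

lemma avoid_upd:
  assumes "f \<in> avoid S" "x \<in> C" "b \<in> A" "\<And>j. j \<in> S \<Longrightarrow> x \<notin> U j"
  shows "f(x := b) \<in> avoid S"
proof -
  have "f(x := b) \<in> occ j \<longleftrightarrow> f \<in> occ j" if "j \<in> S" for j
    using assms(4)[OF that] by (auto simp: occ_def)
  moreover have "f(x := b) \<in> C \<rightarrow>\<^sub>E A" using assms by (auto simp: avoid_def PiE_def extensional_def)
  ultimately show ?thesis using assms by (auto simp: avoid_def)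
qed

lemma card_occ_avoid:
  assumes "i \<in> I" and "\<And>j. j \<in> S \<Longrightarrow> U i \<inter> U j = {}"
  shows "real (card (occ i \<inter> avoid S)) = occ_prob * real (card (avoid S))"
proof -
  have "card A ^ card (U i) * card {f \<in> avoid S. \<forall>x\<in>U i. f x = g i x} = card (avoid S)"
  proof (rule card_agree[OF finC finA U_sub[OF assms(1)] g_in[OF assms(1)]])
    show "f(x := b) \<in> avoid S" if "f \<in> avoid S" "x \<in> U i" "b \<in> A" for f x b
      by (rule avoid_upd) (use that assms U_sub in auto)
  qed (auto simp: avoid_def)
  moreover have "{f \<in> avoid S. \<forall>x\<in>U i. f x = g i x} = occ i \<inter> avoid S" by (auto simp: occ_def)
  ultimately have "real (card A) ^ m * real (card (occ i \<inter> avoid S)) = real (card (avoid S))"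
    using U_card[OF assms(1)] by (metis of_nat_mult of_nat_power)
  then show ?thesis using card_A_ge_1 by (auto simp: occ_prob_def field_simps)
qed

lemma card_two_occ_avoid:
  assumes "i \<in> I" "j \<in> I" and "\<And>l. l \<in> S \<Longrightarrow> (U i \<union> U j) \<inter> U l = {}"
  shows "real (card (occ i \<inter> occ j \<inter> avoid S))
    \<le> occ_prob * (real (card A) ^ card (U i \<inter> U j) / real (card A) ^ m) * real (card (avoid S))"
proof (cases "\<forall>x \<in> U i \<inter> U j. g i x = g j x")
  case False
  then have "occ i \<inter> occ j \<inter> avoid S = {}" by (auto simp: occ_def)
  then show ?thesis using occ_prob_pos by simp
next
  case True
  let ?g = "\<lambda>x. if x \<in> U i then g i x else g j x"
  have "card A ^ card (U i \<union> U j) * card {f \<in> avoid S. \<forall>x\<in>U i \<union> U j. f x = ?g x} = card (avoid S)"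
  proof (rule card_agree[OF finC finA])
    show "f(x := b) \<in> avoid S" if "f \<in> avoid S" "x \<in> U i \<union> U j" "b \<in> A" for f x b
      by (rule avoid_upd) (use that assms U_sub in auto)
    show "U i \<union> U j \<subseteq> C" using U_sub assms by blast
    show "?g x \<in> A" if "x \<in> U i \<union> U j" for x using that g_in assms by auto
  qed (auto simp: avoid_def)
  moreover have "{f \<in> avoid S. \<forall>x\<in>U i \<union> U j. f x = ?g x} = occ i \<inter> occ j \<inter> avoid S"
    using True by (auto simp: occ_def)
  ultimately have *: "real (card A) ^ card (U i \<union> U j) * real (card (occ i \<inter> occ j \<inter> avoid S))
      = real (card (avoid S))"
    by (metis of_nat_mult of_nat_power)
  have "card (U i \<union> U j) + card (U i \<inter> U j) = m + m"
    using card_Un_Int[of "U i" "U j"] U_card assms(1,2) U_sub finC by (metis finite_subset)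
  then have "real (card A) ^ card (U i \<union> U j) * real (card A) ^ card (U i \<inter> U j)
      = real (card A) ^ m * real (card A) ^ m"
    by (metis power_add)
  then have "real (card A) ^ m * real (card A) ^ m * real (card (occ i \<inter> occ j \<inter> avoid S))
      = real (card A) ^ card (U i \<inter> U j) * real (card (avoid S))"
    unfolding *[symmetric] by (simp add: mult_ac)
  then show ?thesis unfolding occ_prob_def using card_A_ge_1
    by (simp add: field_simps)
qed

definition nbrs :: "'i \<Rightarrow> 'i set" where
  "nbrs i = {j \<in> I. j \<noteq> i \<and> U i \<inter> U j \<noteq> {}}"

lemma finite_nbrs: "finite (nbrs i)"
  using finI by (simp add: nbrs_def)

lemma card_nbrs_occ_prob_le: assumes "i \<in> I" shows "real (card (nbrs i)) * occ_prob \<le> 1/4"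
proof -
  have "real (card (nbrs i)) * occ_prob = (\<Sum>j\<in>nbrs i. occ_prob)" by simp
  also have "\<dots> \<le> (\<Sum>j\<in>nbrs i. real (card A) ^ card (U i \<inter> U j) / real (card A) ^ m)"
    unfolding occ_prob_def using card_A_ge_1 by (intro sum_mono divide_right_mono one_le_power) auto
  also have "\<dots> \<le> 1/4" using overlap[OF assms] by (simp add: nbrs_def)
  finally show ?thesis .
qed

lemma avoid_split:
  "avoid S \<subseteq> avoid (S \<union> T) \<union> (\<Union>l\<in>T. occ l \<inter> avoid S)"
  by (auto simp: avoid_def)

lemma card_avoid_split:
  assumes "finite T"
  shows "real (card (avoid S)) \<le> real (card (avoid (S \<union> T))) + (\<Sum>l\<in>T. real (card (occ l \<inter> avoid S)))"
proof -
  have "card (avoid S) \<le> card (avoid (S \<union> T) \<union> (\<Union>l\<in>T. occ l \<inter> avoid S))"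
    by (intro card_mono avoid_split) (auto simp: finite_avoid assms)
  also have "\<dots> \<le> card (avoid (S \<union> T)) + card (\<Union>l\<in>T. occ l \<inter> avoid S)" by (rule card_Un_le)
  also have "\<dots> \<le> card (avoid (S \<union> T)) + (\<Sum>l\<in>T. card (occ l \<inter> avoid S))"
    by (intro add_left_mono card_UN_le assms)
  finally show ?thesis by (simp flip: of_nat_sum of_nat_add)
qed

text \<open>Avoiding the patterns of \<open>S\<close> that meet \<open>U i\<close>, on top of the remaining ones, costs at most a factor
  \<open>2\<close>: by the union bound the lost fraction is at most \<open>card (nbrs i) * 2 * occ_prob \<le> 1/2\<close>. The
  hypothesis \<open>occ\<close> is separate because this lemma is also the induction step of
  \<open>card_occ_avoid_le\<close>.\<close>

lemma card_avoid_far: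
  assumes i: "i \<in> I" and S: "S \<subseteq> I"
    and occ: "\<And>l. l \<in> S \<inter> nbrs i \<Longrightarrow>
      real (card (occ l \<inter> avoid (S - nbrs i))) \<le> 2 * occ_prob * real (card (avoid (S - nbrs i)))"
  shows "real (card (avoid (S - nbrs i))) \<le> 2 * real (card (avoid S))"
proof -
  let ?F = "S - nbrs i"
  have "real (card (avoid ?F)) \<le> real (card (avoid S)) + (\<Sum>l\<in>S \<inter> nbrs i. real (card (occ l \<inter> avoid ?F)))"
    using card_avoid_split[of "S \<inter> nbrs i" ?F] finite_nbrs Un_Diff_Int[of S "nbrs i"] by simp
  also have "\<dots> \<le> real (card (avoid S)) + (\<Sum>l\<in>S \<inter> nbrs i. 2 * occ_prob * real (card (avoid ?F)))"
    using occ by (intro add_left_mono sum_mono)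
  also have "\<dots> \<le> real (card (avoid S)) + real (card (nbrs i)) * occ_prob * (2 * real (card (avoid ?F)))"
    using occ_prob_pos card_mono[OF finite_nbrs, of "S \<inter> nbrs i" i]
    by (auto intro!: mult_right_mono)
  also have "\<dots> \<le> real (card (avoid S)) + 1/4 * (2 * real (card (avoid ?F)))"
    using card_nbrs_occ_prob_le[OF i] by (intro add_left_mono mult_right_mono) auto
  finally show ?thesis by simp
qed

text \<open>The local lemma: conditioning on avoiding other patterns at most doubles the probability that
  pattern \<open>i\<close> occurs. Discard from \<open>S\<close> the patterns that meet \<open>U i\<close>; the remaining condition is
  independent of pattern \<open>i\<close>, and by induction it is at most twice as likely as the original one.\<close>

lemma card_occ_avoid_le:
  assumes "i \<in> I" "S \<subseteq> I"
  shows "real (card (occ i \<inter> avoid S)) \<le> 2 * occ_prob * real (card (avoid S))"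
  using assms
proof (induction "card S" arbitrary: i S rule: less_induct)
  case less
  let ?F = "S - nbrs i"
  have finS: "finite S" using less.prems finI finite_subset by blast
  show ?case
  proof (cases "i \<in> S")
    case True
    then have "occ i \<inter> avoid S = {}" by (auto simp: avoid_def)
    then show ?thesis using occ_prob_pos by simp
  next
    case False
    have far: "real (card (avoid ?F)) \<le> 2 * real (card (avoid S))"
    proof (rule card_avoid_far[OF less.prems])
      fix l assume l: "l \<in> S \<inter> nbrs i"
      have "card ?F < card S" by (rule psubset_card_mono[OF finS]) (use l in auto)
      then show "real (card (occ l \<inter> avoid ?F)) \<le> 2 * occ_prob * real (card (avoid ?F))"
        using l less.prems by (intro less.hyps) auto
    qed
    have "card (occ i \<inter> avoid S) \<le> card (occ i \<inter> avoid ?F)"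
      using finite_avoid avoid_antimono[of ?F S] by (intro card_mono) auto
    then have "real (card (occ i \<inter> avoid S)) \<le> real (card (occ i \<inter> avoid ?F))" by simp
    also have "\<dots> = occ_prob * real (card (avoid ?F))"
      using False less.prems by (intro card_occ_avoid) (auto simp: nbrs_def)
    also have "\<dots> \<le> occ_prob * (2 * real (card (avoid S)))" using far occ_prob_pos by simp
    finally show ?thesis by simp
  qed
qed

text \<open>This replaces the Harris inequality in the proof of Janson's inequality, at the cost of a factor
  \<open>2\<close>. The patterns in \<open>S\<close> are disjoint from \<open>U i\<close>; discarding the patterns that meet \<open>U j\<close> makes it
  independent of both occurrences.\<close>

lemma card_two_occ_avoid_le:
  assumes i: "i \<in> I" and j: "j \<in> I" and S: "S \<subseteq> I" and far: "\<And>l. l \<in> S \<Longrightarrow> U i \<inter> U l = {}"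
  shows "real (card (occ i \<inter> occ j \<inter> avoid S))
    \<le> 2 * occ_prob * (real (card A) ^ card (U i \<inter> U j) / real (card A) ^ m) * real (card (avoid S))"
proof (cases "j \<in> S")
  case True
  then have "occ i \<inter> occ j \<inter> avoid S = {}" by (auto simp: avoid_def)
  then show ?thesis using occ_prob_pos by simp
next
  case False
  let ?F = "S - nbrs j" and ?q = "real (card A) ^ card (U i \<inter> U j) / real (card A) ^ m"
  have le: "real (card (avoid ?F)) \<le> 2 * real (card (avoid S))"
    using S by (intro card_avoid_far[OF j S] card_occ_avoid_le) (auto simp: nbrs_def)
  have "card (occ i \<inter> occ j \<inter> avoid S) \<le> card (occ i \<inter> occ j \<inter> avoid ?F)"
    using finite_avoid avoid_antimono[of ?F S] by (intro card_mono) auto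
  then have "real (card (occ i \<inter> occ j \<inter> avoid S)) \<le> real (card (occ i \<inter> occ j \<inter> avoid ?F))" by simp
  also have "\<dots> \<le> occ_prob * ?q * real (card (avoid ?F))"
  proof (rule card_two_occ_avoid[OF i j])
    fix l assume l: "l \<in> ?F"
    then have "U i \<inter> U l = {}" "U j \<inter> U l = {}" using far S False by (auto simp: nbrs_def)
    then show "(U i \<union> U j) \<inter> U l = {}" by blast
  qed
  also have "\<dots> \<le> occ_prob * ?q * (2 * real (card (avoid S)))"
    using le occ_prob_pos by (intro mult_left_mono) auto
  finally show ?thesis by (simp add: mult_ac)
qed

text \<open>Let \<open>F\<close> be the patterns in \<open>S\<close> that do not meet \<open>U i\<close>. Among the fillings that avoid \<open>F\<close>, the
  fraction \<open>occ_prob\<close> contains pattern \<open>i\<close>, and at most half of these also contain a pattern of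
  \<open>S - F\<close>. The other half avoid all of \<open>S\<close>, so at least the fraction \<open>occ_prob / 2\<close> of the
  fillings that avoid \<open>S\<close> is lost when pattern \<open>i\<close> is added.\<close>

lemma card_avoid_insert:
  assumes i: "i \<in> I" and S: "S \<subseteq> I" and iS: "i \<notin> S"
  shows "real (card (avoid (insert i S))) \<le> (1 - occ_prob/2) * real (card (avoid S))"
proof -
  let ?F = "S - nbrs i" and ?N = "S \<inter> nbrs i"
  let ?q = "\<lambda>j. real (card A) ^ card (U i \<inter> U j) / real (card A) ^ m"
  have far: "\<And>l. l \<in> ?F \<Longrightarrow> U i \<inter> U l = {}" using S iS by (auto simp: nbrs_def)
  have "occ i \<inter> avoid ?F \<subseteq> (occ i \<inter> avoid S) \<union> (\<Union>j\<in>?N. occ i \<inter> occ j \<inter> avoid ?F)"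
    by (auto simp: avoid_def)
  then have "card (occ i \<inter> avoid ?F) \<le> card ((occ i \<inter> avoid S) \<union> (\<Union>j\<in>?N. occ i \<inter> occ j \<inter> avoid ?F))"
    by (intro card_mono) (auto simp: finite_avoid finite_nbrs)
  also have "\<dots> \<le> card (occ i \<inter> avoid S) + card (\<Union>j\<in>?N. occ i \<inter> occ j \<inter> avoid ?F)"
    by (rule card_Un_le)
  also have "\<dots> \<le> card (occ i \<inter> avoid S) + (\<Sum>j\<in>?N. card (occ i \<inter> occ j \<inter> avoid ?F))"
    by (intro add_left_mono card_UN_le) (simp add: finite_nbrs)
  finally have "real (card (occ i \<inter> avoid ?F))
      \<le> real (card (occ i \<inter> avoid S)) + (\<Sum>j\<in>?N. real (card (occ i \<inter> occ j \<inter> avoid ?F)))"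
    by (simp flip: of_nat_sum of_nat_add)
  moreover have "(\<Sum>j\<in>?N. real (card (occ i \<inter> occ j \<inter> avoid ?F))) \<le> occ_prob/2 * real (card (avoid ?F))"
  proof -
    have "(\<Sum>j\<in>?N. real (card (occ i \<inter> occ j \<inter> avoid ?F)))
        \<le> (\<Sum>j\<in>?N. 2 * occ_prob * ?q j * real (card (avoid ?F)))"
      using S far i by (intro sum_mono card_two_occ_avoid_le) (auto simp: nbrs_def)
    also have "\<dots> = 2 * occ_prob * real (card (avoid ?F)) * (\<Sum>j\<in>?N. ?q j)"
      by (simp add: sum_distrib_left mult_ac)
    also have "\<dots> \<le> 2 * occ_prob * real (card (avoid ?F)) * (1/4)"
    proof (intro mult_left_mono)
      have "(\<Sum>j\<in>?N. ?q j) \<le> (\<Sum>j\<in>nbrs i. ?q j)"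
        by (intro sum_mono2) (auto simp: finite_nbrs)
      also have "\<dots> \<le> 1/4" using overlap[OF i] by (simp add: nbrs_def)
      finally show "(\<Sum>j\<in>?N. ?q j) \<le> 1/4" .
    qed (use occ_prob_pos in auto)
    finally show ?thesis by simp
  qed
  moreover have "real (card (occ i \<inter> avoid ?F)) = occ_prob * real (card (avoid ?F))"
    by (intro card_occ_avoid i far)
  ultimately have "occ_prob/2 * real (card (avoid ?F)) \<le> real (card (occ i \<inter> avoid S))" by simp
  moreover have "occ_prob/2 * real (card (avoid S)) \<le> occ_prob/2 * real (card (avoid ?F))"
    using occ_prob_pos card_mono[OF finite_avoid avoid_antimono[of ?F S]]
    by (intro mult_left_mono) auto
  moreover have "real (card (avoid S)) = real (card (avoid (insert i S))) + real (card (occ i \<inter> avoid S))"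
  proof -
    have "avoid S = avoid (insert i S) \<union> (occ i \<inter> avoid S)" by (auto simp: avoid_def)
    moreover have "avoid (insert i S) \<inter> (occ i \<inter> avoid S) = {}" by (auto simp: avoid_def)
    ultimately show ?thesis
      using card_Un_disjoint finite_avoid by (metis finite_Int of_nat_add)
  qed
  ultimately show ?thesis by (simp add: algebra_simps)
qed

lemma occ_prob_le_1: "occ_prob \<le> 1"
  using card_A_ge_1 by (simp add: occ_prob_def)

lemma card_avoid_le: "real (card (avoid I)) \<le> (1 - occ_prob/2) ^ card I * real (card A) ^ card C"
proof -
  have "real (card (avoid S)) \<le> (1 - occ_prob/2) ^ card S * real (card A) ^ card C" if "S \<subseteq> I" for S
    using finite_subset[OF that finI] that
  proof (induction S rule: finite_induct)
    case empty
    have "avoid {} = C \<rightarrow>\<^sub>E A" by (simp add: avoid_def)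
    then show ?case using finC by (simp add: card_PiE)
  next
    case (insert i S)
    have "real (card (avoid (insert i S))) \<le> (1 - occ_prob/2) * real (card (avoid S))"
      using insert by (intro card_avoid_insert) auto
    also have "\<dots> \<le> (1 - occ_prob/2) * ((1 - occ_prob/2) ^ card S * real (card A) ^ card C)"
      using insert occ_prob_le_1 by (intro mult_left_mono) auto
    finally show ?case using insert.hyps by (simp add: mult.assoc)
  qed
  then show ?thesis by blast
qed

end

section \<open>Factorials and binomial coefficients\<close>

text \<open>An upper Stirling bound with the true power \<open>sqrt k\<close>. A bound that loses another factor \<open>sqrt k\<close>
  would only give order \<open>k\<^sup>2\<close> instead of \<open>k ^ 3\<close> for the expected number of copies, and \<open>k\<^sup>2\<close> is
  also the order of the exponent in the union bound. The induction step is \<open>(k + 1/2) * ln (1 + 1/k) \<ge> 1\<close>.\<close>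

lemma ln_fact_le:
  assumes "k \<ge> 1"
  shows "ln (fact k) \<le> 1 + (real k + 1/2) * ln (real k) - real k"
  using assms
proof (induction k rule: nat_induct_at_least)
  case base
  then show ?case by simp
next
  case (Suc k)
  have "2 / (2 * real k + 1) \<le> ln (real k + 1) - ln (real k)"
    using ln_inverse_approx_ge[of "real k" "real k + 1"] Suc.hyps ln_div[of "real k + 1" "real k"]
    by (simp add: add.commute)
  then have "1 \<le> (real k + 1/2) * (ln (real k + 1) - ln (real k))"
    by (simp add: field_simps)
  moreover have "ln (fact (Suc k)) = ln (real k + 1) + ln (fact k)"
    by (simp add: ln_mult add.commute)
  ultimately show ?case using Suc.IH by (simp add: algebra_simps)
qed

lemma ln_fact_ge: "real k * ln (real k) - real k \<le> ln (fact k)"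
proof (induction k)
  case 0
  then show ?case by simp
next
  case (Suc k)
  have "real k * (ln (real k + 1) - ln (real k)) \<le> 1"
  proof (cases "k = 0")
    case False
    have "ln (real k + 1) - ln (real k) = ln ((real k + 1) / real k)"
      using False by (subst ln_div) auto
    also have "\<dots> \<le> (real k + 1) / real k - 1" using False by (intro ln_le_minus_one) simp
    also have "\<dots> = 1 / real k" using False by (simp add: field_simps)
    finally have "ln (real k + 1) - ln (real k) \<le> 1 / real k" .
    from mult_left_mono[OF this, of "real k"] show ?thesis using False by simp
  qed simp
  moreover have "ln (fact (Suc k)) = ln (real k + 1) + ln (fact k)"
    by (simp add: ln_mult add.commute)
  ultimately show ?case using Suc.IH by (simp add: algebra_simps)
qed

text \<open>Here \<open>y\<close> plays the role of \<open>e (n - k) / k\<close>: the bound is \<open>(n - k) ^ k / k!\<close>, with \<open>k!\<close>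
  estimated by \<open>ln_fact_le\<close>.\<close>

lemma choose_ge_exp:
  assumes k: "k \<ge> 1" and y: "y > 0" "real k / exp 1 * y \<le> real n - real k"
  shows "exp (real k * ln y - 1 - ln (real k) / 2) \<le> real (n choose k)"
proof -
  have kn: "k < n" using assms
    by (smt (verit) divide_pos_pos exp_gt_zero mult_pos_pos of_nat_0_less_iff of_nat_less_iff
        not_one_le_zero gr0I)
  have "(real n - real k) ^ k \<le> (\<Prod>i = 0..<k. real n - real i)"
    using kn prod_mono[of "{0..<k}" "\<lambda>_. real n - real k" "\<lambda>i. real n - real i"] by simp
  also have "\<dots> = fact k * real (n choose k)"
    by (simp add: binomial_gbinomial gbinomial_mult_fact)
  finally have le: "(real n - real k) ^ k \<le> fact k * real (n choose k)" .
  have C: "real (n choose k) > 0" using kn by simp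
  have "real k * ln (real n - real k) \<le> ln (fact k) + ln (real (n choose k))"
    using le kn C ln_le_cancel_iff[of "(real n - real k) ^ k" "fact k * real (n choose k)"]
    by (simp add: ln_mult ln_realpow)
  moreover have "ln (real k) - 1 + ln y \<le> ln (real n - real k)"
  proof -
    have "ln (real k / exp 1 * y) = ln (real k) - 1 + ln y"
      using k y by (simp add: ln_mult ln_div)
    moreover have "ln (real k / exp 1 * y) \<le> ln (real n - real k)"
      using k y by (intro ln_mono) auto
    ultimately show ?thesis by simp
  qed
  then have "real k * (ln (real k) - 1 + ln y) \<le> real k * ln (real n - real k)"
    by (intro mult_left_mono) auto
  ultimately have "real k * ln y - 1 - ln (real k) / 2 \<le> ln (real (n choose k))"
    using ln_fact_le[OF k] by (simp add: algebra_simps)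
  then show ?thesis using C by (simp add: ln_ge_iff)
qed

lemma choose_le_power:
  assumes x: "x \<ge> 1"
  shows "real (n choose x) \<le> (exp 1 * real n / real x) ^ x"
proof -
  have "exp (real x * ln (real x) - real x) \<le> fact x"
    using ln_fact_ge[of x] by (simp add: ln_ge_iff)
  moreover have "exp (real x * ln (real x) - real x) = (real x / exp 1) ^ x"
  proof -
    have "real x * ln (real x) - real x = real x * ln (real x / exp 1)"
      using x by (simp add: ln_div algebra_simps)
    then show ?thesis using x by (simp add: exp_of_nat_mult)
  qed
  ultimately have "real (n choose x) * (real x / exp 1) ^ x \<le> real (n choose x) * fact x"
    by (intro mult_left_mono) auto
  also have "\<dots> = real ((n choose x) * fact x)" by simp
  also have "\<dots> \<le> real (n ^ x)" by (rule of_nat_mono[OF binomial_fact_pow])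
  finally show ?thesis using x by (simp add: field_simps power_divide power_mult_distrib)
qed

lemma choose_le_power_min:
  assumes "x \<le> k"
  shows "real (k choose x) \<le> real k ^ min x (k - x)"
  using binomial_le_pow[of x k] binomial_le_pow[of "k - x" k] binomial_symmetric[of x k] assms
  by (auto simp: min_def simp flip: of_nat_power)

text \<open>For \<open>x\<close> close to \<open>k\<close> the ratio is \<open>1 + (k - x) / x\<close>, and its power is at most \<open>e ^ (k - x)\<close>.\<close>

lemma ratio_power_le:
  assumes k: "k \<ge> 3" and x: "1 \<le> x" "x \<le> k"
  shows "(real k / real x) ^ x \<le> real k ^ min x (k - x)"
proof (cases "x \<le> k - x")
  case True
  have "(real k / real x) ^ x \<le> real k ^ x"
    using x by (intro power_mono) (auto simp: field_simps)
  then show ?thesis using True by simp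
next
  case False
  have "(real k / real x) ^ x = (1 + real (k - x) / real x) ^ x"
    using x by (simp add: field_simps of_nat_diff)
  also have "\<dots> \<le> exp (real (k - x))"
    using x by (intro exp_ge_one_plus_x_over_n_power_n) auto
  also have "\<dots> = exp 1 ^ (k - x)" by (simp flip: exp_of_nat_mult)
  also have "\<dots> \<le> real k ^ (k - x)"
    using k exp_le by (intro power_mono) auto
  finally show ?thesis using False by simp
qed

section \<open>The weight of overlapping positions\<close>

text \<open>An upper bound for the number of ways to replace \<open>x\<close> out of \<open>k\<close> rows. Used with \<open>L = a powr (k / 2)\<close>, only \<open>L ^ x\<close> is
  exponential when \<open>x\<close> is close to \<open>0\<close> or to \<open>k\<close>; the factor \<open>k\<^sup>2\<close> comes from
  \<open>(1 + 2 * ln k / k) ^ x \<le> exp (2 * ln k)\<close>.\<close>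

lemma choose_product_le:
  fixes L :: real
  assumes k: "k \<ge> 3" and x: "x \<le> k" and L: "L \<ge> 0"
    and n: "real n \<le> real k * L / exp 1 * (1 + 2 * ln (real k) / real k)"
  shows "real ((k choose x) * (n choose x)) \<le> real k ^ 2 * L ^ x * real k ^ (2 * min x (k - x))"
proof (cases "x = 0")
  case True
  then show ?thesis using k by simp
next
  case False
  let ?e = "1 + 2 * ln (real k) / real k"
  have e1: "?e \<ge> 1" using k by simp
  have "real (n choose x) \<le> (exp 1 * real n / real x) ^ x"
    using False by (intro choose_le_power) auto
  also have "\<dots> \<le> ((real k / real x) * L * ?e) ^ x"
  proof (intro power_mono)
    have "exp 1 * real n \<le> exp 1 * (real k * L / exp 1 * ?e)"
      by (rule mult_left_mono[OF n]) simp
    then have "exp 1 * real n \<le> real k * L * ?e" by simp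
    then have "exp 1 * real n / real x \<le> real k * L * ?e / real x" by (intro divide_right_mono) auto
    then show "exp 1 * real n / real x \<le> (real k / real x) * L * ?e" by simp
  qed simp
  also have "\<dots> = (real k / real x) ^ x * L ^ x * ?e ^ x" by (simp add: power_mult_distrib power_divide)
  also have "\<dots> \<le> real k ^ min x (k - x) * L ^ x * real k ^ 2"
  proof (intro mult_mono)
    show "(real k / real x) ^ x \<le> real k ^ min x (k - x)"
      using False k x by (intro ratio_power_le) auto
    have "?e ^ x \<le> ?e ^ k" using e1 x by (intro power_increasing) auto
    also have "\<dots> \<le> exp (2 * ln (real k))"
      using k by (intro exp_ge_one_plus_x_over_n_power_n) (auto intro: order_trans[of _ 0])
    also have "\<dots> = real k ^ 2" using k by (simp add: exp_double)
    finally show "?e ^ x \<le> real k ^ 2" .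
  qed (use e1 L in auto)
  finally have "real (n choose x) \<le> real k ^ min x (k - x) * L ^ x * real k ^ 2" .
  then have "real (k choose x) * real (n choose x)
      \<le> real k ^ min x (k - x) * (real k ^ min x (k - x) * L ^ x * real k ^ 2)"
    using choose_le_power_min[OF x] by (intro mult_mono) auto
  also have "\<dots> = real k ^ 2 * L ^ x * real k ^ (2 * min x (k - x))"
    by (simp add: mult_2 power_add mult_ac)
  finally show ?thesis by simp
qed

text \<open>The right-hand side is \<open>8\<close> times the gain in the exponent of \<open>1 / a\<close>. It vanishes only when \<open>(x, y)\<close>
  is one of the corners \<open>(0, 0)\<close> (the same position) and \<open>(k, k)\<close> (no shared row or column), and it
  grows at least linearly with the distance from the nearer of the two. When \<open>x\<close> and \<open>y\<close> lie in opposite halves of the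
  range it is at least \<open>k\<^sup>2\<close>, while the left-hand side never exceeds \<open>k\<^sup>2\<close>.\<close>

lemma overlap_exponent:
  fixes x y k :: nat
  assumes "x \<le> k" "y \<le> k"
  shows "k * (min x (k - x) + min y (k - y)) \<le> 4 * (x * (k - y) + y * (k - x))"
proof -
  define r s where "r = k - x" and "s = k - y"
  have k: "k = x + r" "k = y + s" using assms by (simp_all add: r_def s_def)
  consider "x \<le> r" "y \<le> s" | "r \<le> x" "s \<le> y" | "x \<le> r" "s \<le> y" | "r \<le> x" "y \<le> s" by linarith
  then have "k * (min x r + min y s) \<le> 4 * (x * s + y * r)"
  proof cases
    case 1
    have "k * (x + y) = k * x + k * y" by (rule distrib_left)
    also have "\<dots> \<le> (2 * s) * x + (2 * r) * y" using 1 k by (intro add_mono mult_right_mono) auto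
    finally have "k * (x + y) \<le> 2 * (x * s + y * r)" by (simp add: algebra_simps)
    then show ?thesis using 1 by simp
  next
    case 2
    have "k * (r + s) = k * r + k * s" by (rule distrib_left)
    also have "\<dots> \<le> (2 * y) * r + (2 * x) * s" using 2 k by (intro add_mono mult_right_mono) auto
    finally have "k * (r + s) \<le> 2 * (x * s + y * r)" by (simp add: algebra_simps)
    then show ?thesis using 2 by simp
  next
    case 3
    have "x + s \<le> k" using 3 k by linarith
    then have "k * (x + s) \<le> k * k" by simp
    also have "\<dots> \<le> (2 * y) * (2 * r)" using 3 k by (intro mult_mono) auto
    finally show ?thesis using 3 by (simp add: algebra_simps)
  next
    case 4
    have "r + y \<le> k" using 4 k by linarith
    then have "k * (r + y) \<le> k * k" by simp
    also have "\<dots> \<le> (2 * x) * (2 * s)" using 4 k by (intro mult_mono) auto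
    finally show ?thesis using 4 by (simp add: algebra_simps)
  qed
  then show ?thesis by (simp add: r_def s_def)
qed

text \<open>With \<open>u = min x (k - x)\<close> and \<open>v = min y (k - y)\<close> the product is at most
  \<open>k ^ 4 * (k\<^sup>2 * a powr (- k / 8)) ^ (u + v)\<close>: each unit of \<open>u + v\<close> costs \<open>k\<^sup>2\<close> in the
  binomial coefficients and gains \<open>a powr (- k / 8)\<close> by \<open>overlap_exponent\<close>. Since \<open>u + v \<ge> 1\<close> and
  the base is at most \<open>1\<close>, one factor bounds the whole power.\<close>

lemma overlap_term_le:
  fixes a :: real
  assumes a: "a \<ge> 1" and k: "k \<ge> 3" and xy: "x < k" "y < k" "(x, y) \<noteq> (0, 0)"
    and n: "real n \<le> real k * a powr (real k / 2) / exp 1 * (1 + 2 * ln (real k) / real k)"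
    and q: "real k ^ 2 * a powr (- real k / 8) \<le> 1"
  shows "real ((k choose x) * (n choose x)) * real ((k choose y) * (n choose y))
      * a ^ ((k - x) * (k - y)) / a ^ (k * k) \<le> real k ^ 6 * a powr (- real k / 8)"
proof -
  define u v where "u = min x (k - x)" and "v = min y (k - y)"
  let ?L = "a powr (real k / 2)" and ?q = "real k ^ 2 * a powr (- real k / 8)"
  have uv: "u + v \<ge> 1" using xy by (auto simp: u_def v_def min_def)
  have a0: "a > 0" using a by simp
  have "?L ^ x * ?L ^ y * a ^ ((k - x) * (k - y)) / a ^ (k * k)
      = a powr (real k / 2 * real x + real k / 2 * real y + real ((k - x) * (k - y)) - real (k * k))"
  proof -
    have L: "?L ^ i = a powr (real k / 2 * real i)" for i
      using a0 powr_power[of a "real k / 2" i] by (simp add: mult.commute)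
    have pow: "a ^ i = a powr real i" for i using a0 by (simp add: powr_realpow)
    show ?thesis unfolding L pow by (simp only: powr_add powr_diff)
  qed
  also have "\<dots> \<le> a powr (- real k / 8 * real (u + v))"
  proof (rule powr_mono[OF _ a])
    have "real (k * (u + v)) \<le> real (4 * (x * (k - y) + y * (k - x)))"
      unfolding u_def v_def using xy overlap_exponent[of x k y] by (simp only: of_nat_le_iff less_imp_le)
    moreover have d: "real (k - x) = real k - real x" "real (k - y) = real k - real y"
      using xy by (simp_all add: of_nat_diff)
    ultimately have "real k * (real u + real v)
        \<le> 4 * (real x * (real k - real y) + real y * (real k - real x))"
      by (simp only: of_nat_mult of_nat_add of_nat_numeral d)
    then show "real k / 2 * real x + real k / 2 * real y + real ((k - x) * (k - y)) - real (k * k)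
        \<le> - real k / 8 * real (u + v)"
      unfolding of_nat_mult of_nat_add d by (simp add: field_simps)
  qed
  also have "\<dots> = (a powr (- real k / 8)) ^ (u + v)"
    using a0 powr_power[of a "- real k / 8" "u + v"] by (simp add: mult.commute)
  finally have pw: "?L ^ x * ?L ^ y * a ^ ((k - x) * (k - y)) / a ^ (k * k) \<le> (a powr (- real k / 8)) ^ (u + v)" .
  have "real ((k choose x) * (n choose x)) * real ((k choose y) * (n choose y)) * (a ^ ((k - x) * (k - y)) / a ^ (k * k))
    \<le> (real k ^ 2 * ?L ^ x * real k ^ (2 * u)) * (real k ^ 2 * ?L ^ y * real k ^ (2 * v))
      * (a ^ ((k - x) * (k - y)) / a ^ (k * k))"
    unfolding u_def v_def using xy a
    by (intro mult_mono choose_product_le[OF k _ _ n] mult_nonneg_nonneg divide_nonneg_nonneg zero_le_power) auto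
  also have "\<dots> = real k ^ 4 * real k ^ (2 * (u + v)) * (?L ^ x * ?L ^ y * a ^ ((k - x) * (k - y)) / a ^ (k * k))"
    by (simp add: algebra_simps power_add power2_eq_square power4_eq_xxxx)
  also have "\<dots> \<le> real k ^ 4 * real k ^ (2 * (u + v)) * (a powr (- real k / 8)) ^ (u + v)"
    using pw by (intro mult_left_mono) auto
  also have "\<dots> = real k ^ 4 * ?q ^ (u + v)" by (simp only: power_mult power_mult_distrib mult.assoc)
  also have "\<dots> \<le> real k ^ 4 * ?q"
    using power_decreasing[OF uv _ q] by (intro mult_left_mono) auto
  finally show ?thesis by simp
qed

lemma overlap_sum_le:
  fixes a :: real
  assumes a: "a \<ge> 1" and k: "k \<ge> 3"
    and n: "real n \<le> real k * a powr (real k / 2) / exp 1 * (1 + 2 * ln (real k) / real k)"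
    and q: "real k ^ 8 * a powr (- real k / 8) \<le> 1/4"
  shows "(\<Sum>(x, y) \<in> {..<k} \<times> {..<k} - {(0, 0)}.
      real ((k choose x) * (n choose x)) * real ((k choose y) * (n choose y))
      * a ^ ((k - x) * (k - y)) / a ^ (k * k)) \<le> 1/4"
proof -
  have "real k ^ 2 * a powr (- real k / 8) \<le> real k ^ 8 * a powr (- real k / 8)"
    using k by (intro mult_right_mono power_increasing) auto
  then have q': "real k ^ 2 * a powr (- real k / 8) \<le> 1" using q by simp
  have "(\<Sum>(x, y) \<in> {..<k} \<times> {..<k} - {(0, 0)}.
      real ((k choose x) * (n choose x)) * real ((k choose y) * (n choose y))
      * a ^ ((k - x) * (k - y)) / a ^ (k * k))
    \<le> (\<Sum>(x, y) \<in> {..<k} \<times> {..<k} - {(0, 0)}. real k ^ 6 * a powr (- real k / 8))"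
  proof (rule sum_mono)
    fix z assume z: "z \<in> {..<k} \<times> {..<k} - {(0, 0)}"
    obtain x y where xy: "z = (x, y)" by (cases z)
    show "(case z of (x, y) \<Rightarrow> real ((k choose x) * (n choose x)) * real ((k choose y) * (n choose y))
        * a ^ ((k - x) * (k - y)) / a ^ (k * k)) \<le> (case z of (x, y) \<Rightarrow> real k ^ 6 * a powr (- real k / 8))"
      unfolding xy prod.case by (rule overlap_term_le[OF a k _ _ _ n q']) (use z xy in auto)
  qed
  also have "\<dots> = real (card ({..<k} \<times> {..<k} - {(0::nat, 0::nat)})) * (real k ^ 6 * a powr (- real k / 8))"
    by (simp add: case_prod_unfold)
  also have "\<dots> \<le> real (k * k) * (real k ^ 6 * a powr (- real k / 8))"
    using card_mono[of "{..<k} \<times> {..<k}" "{..<k} \<times> {..<k} - {(0::nat, 0::nat)}"]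
    by (intro mult_right_mono of_nat_mono) (auto simp: card_cartesian_product)
  also have "\<dots> = real k ^ 8 * a powr (- real k / 8)" by (simp add: eval_nat_numeral)
  finally show ?thesis using q by simp
qed

section \<open>The expected number of copies\<close>

text \<open>By \<open>choose_ge_exp\<close> with \<open>y = a powr (k / 2) * z\<close>, where
  \<open>z = 1 + 2 * ln k / k - 6 / 2 powr (k / 2)\<close>, the right-hand side is a lower bound for the expected number of
  copies of a matrix. It is of order \<open>k ^ 3\<close>. The term \<open>6 / 2 powr (k / 2)\<close> pays for passing from
  the claimed bound to its integer part \<open>n\<close>, and then to \<open>n - k\<close>.\<close>

lemma eventually_copies_exceed:
  fixes c :: real
  shows "\<forall>\<^sub>F k::nat in sequentially.
    2 * c * real k ^ 2 <
      exp (2 * (real k * ln (1 + 2 * ln (real k) / real k - 6 / 2 powr (real k / 2)) - 1 - ln (real k) / 2))"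
  by real_asymp

lemma eventually_copies_base_pos:
  shows "\<forall>\<^sub>F k::nat in sequentially. 1 + 2 * ln (real k) / real k - 6 / 2 powr (real k / 2) > 0"
  by real_asymp

lemma eventually_overlap_weight_small:
  shows "\<forall>\<^sub>F k::nat in sequentially. real k ^ 8 * 2 powr (- real k / 8) \<le> 1/4"
  by real_asymp

text \<open>The left-hand side of the conclusion is the union bound on the probability that some \<open>k \<times> k\<close> matrix
  is missing.\<close>

lemma copies_beat_union_bound:
  fixes a :: real
  assumes a: "a \<ge> 2" and k: "k \<ge> 1"
    and n: "real n \<ge> real k * a powr (real k / 2) / exp 1 * (1 + 2 * ln (real k) / real k) - 1"
    and z: "1 + 2 * ln (real k) / real k - 6 / 2 powr (real k / 2) > 0"
    and c: "2 * ln a * real k ^ 2 <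
      exp (2 * (real k * ln (1 + 2 * ln (real k) / real k - 6 / 2 powr (real k / 2)) - 1 - ln (real k) / 2))"
  shows "a ^ (k * k) * (1 - 1 / a ^ (k * k) / 2) ^ ((n choose k) * (n choose k)) < 1"
proof -
  let ?L = "a powr (real k / 2)"
  define z where "z = 1 + 2 * ln (real k) / real k - 6 / 2 powr (real k / 2)"
  define E where "E = real k * ln z - 1 - ln (real k) / 2"
  have z0: "z > 0" using z by (simp add: z_def)
  have "2 powr (real k / 2) \<le> ?L" using a by (intro powr_mono2) auto
  then have "6 \<le> 6 / 2 powr (real k / 2) * ?L" by (simp add: field_simps)
  then have "?L * z \<le> ?L * (1 + 2 * ln (real k) / real k) - 6" by (simp add: z_def algebra_simps)
  then have "real k / exp 1 * (?L * z) \<le> real k / exp 1 * (?L * (1 + 2 * ln (real k) / real k) - 6)"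
    by (intro mult_left_mono) auto
  also have "\<dots> = real k * ?L / exp 1 * (1 + 2 * ln (real k) / real k) - 6 * real k / exp 1"
    by (simp add: algebra_simps diff_divide_distrib add_divide_distrib)
  also have "\<dots> \<le> real n - real k"
  proof -
    \<comment> \<open>Of these \<open>2 k \<ge> k + 1\<close>, one \<open>k\<close> is for \<open>n - k\<close> and the rest for rounding down to \<open>n\<close>.\<close>
    have "6 * real k / exp 1 \<ge> 2 * real k" using exp_le k by (simp add: field_simps)
    then show ?thesis using n k by simp
  qed
  finally have "exp (real k * ln (?L * z) - 1 - ln (real k) / 2) \<le> real (n choose k)"
    using z0 a by (intro choose_ge_exp k) auto
  moreover have "real k * ln (?L * z) - 1 - ln (real k) / 2 = real k * real k / 2 * ln a + E"
    using z0 a by (simp add: E_def ln_mult ln_powr algebra_simps)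
  ultimately have C: "exp (real k * real k / 2 * ln a + E) \<le> real (n choose k)" by simp
  have ak: "a ^ (k * k) = exp (real k * real k * ln a)"
    using a by (simp add: exp_of_nat_mult[of "k * k", simplified])
  have "exp (real k * real k / 2 * ln a + E) * exp (real k * real k / 2 * ln a + E) \<le> real (n choose k) * real (n choose k)"
    using C by (intro mult_mono) auto
  also have "exp (real k * real k / 2 * ln a + E) * exp (real k * real k / 2 * ln a + E) = a ^ (k * k) * exp (2 * E)"
    unfolding ak by (simp flip: exp_add add: algebra_simps)
  finally have N: "a ^ (k * k) * exp (2 * E) \<le> real ((n choose k) * (n choose k))" by simp
  have "a ^ (k * k) * (1 - 1 / a ^ (k * k) / 2) ^ ((n choose k) * (n choose k))
    \<le> a ^ (k * k) * exp (- (1 / a ^ (k * k) / 2)) ^ ((n choose k) * (n choose k))"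
  proof (intro mult_left_mono power_mono)
    show "1 - 1 / a ^ (k * k) / 2 \<le> exp (- (1 / a ^ (k * k) / 2))"
      using exp_ge_add_one_self[of "- (1 / a ^ (k * k) / 2)"] by simp
    have "a ^ (k * k) \<ge> 1" using a by simp
    then show "0 \<le> 1 - 1 / a ^ (k * k) / 2" by (simp add: field_simps)
  qed (use a in auto)
  also have "\<dots> = exp (real k * real k * ln a - real ((n choose k) * (n choose k)) / a ^ (k * k) / 2)"
  proof -
    let ?N = "(n choose k) * (n choose k)"
    have "exp (- (1 / a ^ (k * k) / 2)) ^ ?N = exp (- real ?N / a ^ (k * k) / 2)"
      unfolding exp_of_nat_mult[symmetric] by simp
    then show ?thesis by (subst (1) ak) (simp flip: exp_add)
  qed
  also have "\<dots> < 1"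
  proof -
    have "exp (2 * E) \<le> real ((n choose k) * (n choose k)) / a ^ (k * k)"
      using N a by (simp add: field_simps)
    then show ?thesis using c by (simp add: E_def z_def power2_eq_square mult_ac)
  qed
  finally show ?thesis .
qed

section \<open>Positions in a matrix\<close>

definition positions :: "nat \<Rightarrow> nat \<Rightarrow> (nat set \<times> nat set) set" where
  "positions n k = {R. R \<subseteq> {..<n} \<and> card R = k} \<times> {S. S \<subseteq> {..<n} \<and> card S = k}"

lemma finite_positions: "finite (positions n k)"
  unfolding positions_def by (intro finite_cartesian_product) (auto intro: finite_subset[of _ "Pow {..<n}"])

lemma card_positions: "card (positions n k) = (n choose k) * (n choose k)"
  unfolding positions_def by (simp add: card_cartesian_product n_subsets)

text \<open>Such a set is determined by the \<open>x\<close> elements of \<open>R\<close> that it omits and the \<open>x\<close> elements outside \<open>R\<close>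
  that it contains.\<close>

lemma card_subsets_at_distance_le:
  assumes fin: "finite N" and R: "R \<subseteq> N" "card R = k"
  shows "card {R'. R' \<subseteq> N \<and> card R' = k \<and> card (R - R') = x} \<le> (k choose x) * (card N choose x)"
    (is "card ?T \<le> _")
proof -
  have finR: "finite R" using R fin finite_subset by blast
  have inj: "inj_on (\<lambda>R'. (R - R', R' - R)) ?T" by (rule inj_onI) blast
  have "card (R' - R) = x" if "R' \<subseteq> N" "card R' = k" "card (R - R') = x" for R'
  proof -
    have "finite R'" using that fin finite_subset by blast
    then have "card (R' - R) = card (R - R')"
      using finR R that by (simp add: card_Diff_subset_Int Int_commute)
    then show ?thesis using that by simp
  qed
  then have img: "(\<lambda>R'. (R - R', R' - R)) ` ?T
      \<subseteq> {X. X \<subseteq> R \<and> card X = x} \<times> {Y. Y \<subseteq> N \<and> card Y = x}"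
    by auto
  have "card ?T \<le> card ({X. X \<subseteq> R \<and> card X = x} \<times> {Y. Y \<subseteq> N \<and> card Y = x})"
    using finR fin by (intro card_inj_on_le[OF inj img] finite_cartesian_product)
      (auto intro: finite_subset[of _ "Pow _"])
  then show ?thesis using n_subsets[OF finR] n_subsets[OF fin] R by (simp add: card_cartesian_product)
qed

text \<open>The positions that meet \<open>i\<close> are grouped by the numbers \<open>x\<close> of rows and \<open>y\<close> of columns in which
  they differ from \<open>i\<close>. Meeting forces \<open>x, y < k\<close>, and \<open>(x, y) = (0, 0)\<close> would be \<open>i\<close> itself.\<close>

lemma position_overlap_sum_le:
  fixes a :: real
  assumes a: "a \<ge> 0" and i: "i \<in> positions n k"
  defines "U \<equiv> \<lambda>(R, S). R \<times> S"
  shows "(\<Sum>j | j \<in> positions n k \<and> j \<noteq> i \<and> U i \<inter> U j \<noteq> {}. a ^ card (U i \<inter> U j) / a ^ (k * k))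
    \<le> (\<Sum>(x, y) \<in> {..<k} \<times> {..<k} - {(0, 0)}.
      real ((k choose x) * (n choose x)) * real ((k choose y) * (n choose y))
      * a ^ ((k - x) * (k - y)) / a ^ (k * k))"
    (is "sum _ ?J \<le> sum _ ?W")
proof -
  obtain R S where RS: "i = (R, S)" by (cases i)
  have R: "R \<subseteq> {..<n}" "card R = k" and S: "S \<subseteq> {..<n}" "card S = k"
    using i by (auto simp: RS positions_def)
  have fin: "finite R" "finite S" using R S finite_subset by blast+
  let ?h = "\<lambda>(R', S'). (card (R - R'), card (S - S'))"
  let ?w = "\<lambda>(x, y). a ^ ((k - x) * (k - y)) / a ^ (k * k)"
  have meet: "card (X \<inter> X') = k - card (X - X')" "card (X - X') \<le> k" "card (X - X') = 0 \<longleftrightarrow> X \<subseteq> X'"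
    if "finite X" "card X = k" for X X' :: "nat set"
    using that card_Int_Diff[of X X'] by auto
  have h: "?h j \<in> ?W \<and> a ^ card (U i \<inter> U j) / a ^ (k * k) = ?w (?h j)" if j: "j \<in> ?J" for j
  proof -
    obtain R' S' where RS': "j = (R', S')" by (cases j)
    have R': "R' \<subseteq> {..<n}" "card R' = k" and S': "S' \<subseteq> {..<n}" "card S' = k"
      using j by (auto simp: RS' positions_def)
    have I: "U i \<inter> U j = (R \<inter> R') \<times> (S \<inter> S')" by (auto simp: RS RS' U_def)
    then have ne: "R \<inter> R' \<noteq> {}" "S \<inter> S' \<noteq> {}" using j by auto
    then have "card (R \<inter> R') > 0" "card (S \<inter> S') > 0" using fin by auto
    then have "card (R - R') < k" "card (S - S') < k"
      using meet[of R R'] meet[of S S'] fin R S by auto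
    moreover have "(card (R - R'), card (S - S')) \<noteq> (0, 0)"
    proof
      assume "(card (R - R'), card (S - S')) = (0, 0)"
      then have "R \<subseteq> R'" "S \<subseteq> S'" using meet(3) fin R S by auto
      then have "R = R'" "S = S'"
        using R' S' R S card_subset_eq finite_subset finite_lessThan by metis+
      then show False using j by (simp add: RS RS')
    qed
    moreover have "card (U i \<inter> U j) = (k - card (R - R')) * (k - card (S - S'))"
      unfolding I card_cartesian_product using meet(1) fin R S by simp
    ultimately show ?thesis by (simp add: RS')
  qed
  have finJ: "finite ?J" using finite_positions by simp
  have "(\<Sum>j\<in>?J. a ^ card (U i \<inter> U j) / a ^ (k * k)) = (\<Sum>j\<in>?J. ?w (?h j))"
    using h by (intro sum.cong) auto
  also have "\<dots> = (\<Sum>z\<in>?W. \<Sum>j\<in>{j \<in> ?J. ?h j = z}. ?w (?h j))"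
    using h finJ by (intro sum.group[symmetric]) auto
  also have "\<dots> = (\<Sum>z\<in>?W. real (card {j \<in> ?J. ?h j = z}) * ?w z)"
    by (intro sum.cong) auto
  also have "\<dots> \<le> (\<Sum>(x, y)\<in>?W. real ((k choose x) * (n choose x)) * real ((k choose y) * (n choose y))
      * a ^ ((k - x) * (k - y)) / a ^ (k * k))"
  proof (rule sum_mono)
    fix z assume "z \<in> ?W"
    obtain x y where z: "z = (x, y)" by (cases z)
    let ?A = "{R'. R' \<subseteq> {..<n} \<and> card R' = k \<and> card (R - R') = x}"
    let ?B = "{S'. S' \<subseteq> {..<n} \<and> card S' = k \<and> card (S - S') = y}"
    have "{j \<in> ?J. ?h j = z} \<subseteq> ?A \<times> ?B" by (auto simp: z positions_def)
    then have "card {j \<in> ?J. ?h j = z} \<le> card (?A \<times> ?B)"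
      by (intro card_mono finite_cartesian_product) (auto intro: finite_subset[of _ "Pow {..<n}"])
    also have "\<dots> \<le> ((k choose x) * (n choose x)) * ((k choose y) * (n choose y))"
      unfolding card_cartesian_product
      using card_subsets_at_distance_le[OF _ R, of x] card_subsets_at_distance_le[OF _ S, of y]
      by (intro mult_mono) auto
    finally have "real (card {j \<in> ?J. ?h j = z})
        \<le> real ((k choose x) * (n choose x)) * real ((k choose y) * (n choose y))"
      by (simp only: of_nat_le_iff flip: of_nat_mult)
    then have "real (card {j \<in> ?J. ?h j = z}) * ?w z
        \<le> real ((k choose x) * (n choose x)) * real ((k choose y) * (n choose y)) * ?w z"
      using a by (intro mult_right_mono) (auto simp: z)
    then show "real (card {j \<in> ?J. ?h j = z}) * ?w z \<le> (case z of (x, y) \<Rightarrow>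
        real ((k choose x) * (n choose x)) * real ((k choose y) * (n choose y))
        * a ^ ((k - x) * (k - y)) / a ^ (k * k))"
      by (simp add: z)
  qed
  finally show ?thesis .
qed

lemma card_square_mats_le: "card (square_mats k a) \<le> a ^ (k * k)"
proof -
  let ?D = "{..<k} \<times> {..<k}"
  have "square_mats k a \<subseteq> (\<lambda>f. Matrix.mat k k f) ` (?D \<rightarrow>\<^sub>E {1..a})"
  proof
    fix A assume "A \<in> square_mats k a"
    then have c: "A \<in> carrier_mat k k" and e: "elements_mat A \<subseteq> {1..a}"
      by (auto simp: square_mats_def)
    have "A = Matrix.mat k k (restrict (\<lambda>p. A $$ p) ?D)"
      using c by (intro eq_matI) auto
    moreover have "restrict (\<lambda>p. A $$ p) ?D \<in> ?D \<rightarrow>\<^sub>E {1..a}"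
      using e elements_matI[OF c _ _ refl] by (intro restrict_PiE_iff[THEN iffD2]) blast
    ultimately show "A \<in> (\<lambda>f. Matrix.mat k k f) ` (?D \<rightarrow>\<^sub>E {1..a})" by blast
  qed
  then have "card (square_mats k a) \<le> card (?D \<rightarrow>\<^sub>E {1..a})"
    by (rule surj_card_le[rotated]) (auto intro: finite_PiE)
  then show ?thesis by (simp add: card_PiE card_cartesian_product)
qed

text \<open>The entry that cell \<open>(p, q)\<close> must have for \<open>B\<close> to appear on the rows \<open>R\<close> and the columns \<open>S\<close>: the
  two cardinalities are the ranks of \<open>p\<close> in \<open>R\<close> and of \<open>q\<close> in \<open>S\<close>, so they invert \<open>pick\<close>.\<close>

definition pattern :: "nat mat \<Rightarrow> nat set \<times> nat set \<Rightarrow> nat \<times> nat \<Rightarrow> nat" where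
  "pattern B = (\<lambda>(R, S) (p, q). B $$ (card {r \<in> R. r < p}, card {s \<in> S. s < q}))"

lemma card_below_less:
  fixes R :: "nat set"
  assumes "finite R" "p \<in> R"
  shows "card {r \<in> R. r < p} < card R"
proof (rule psubset_card_mono[OF assms(1)])
  have "p \<notin> {r \<in> R. r < p}" by simp
  then show "{r \<in> R. r < p} \<subset> R" using assms(2) by blast
qed

lemma pattern_in:
  assumes B: "B \<in> square_mats k a" and RS: "(R, S) \<in> positions n k" and pq: "p \<in> R" "q \<in> S"
  shows "pattern B (R, S) (p, q) \<in> {1..a}"
proof -
  have "card {r \<in> R. r < p} < k" "card {s \<in> S. s < q} < k"
    using card_below_less[of R p] card_below_less[of S q] RS pq finite_subset[of _ "{..<n}"]
    by (auto simp: positions_def)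
  then have "pattern B (R, S) (p, q) \<in> elements_mat B"
    using B elements_matI[of B k k] by (simp add: pattern_def square_mats_def)
  then show ?thesis using B unfolding square_mats_def by blast
qed

lemma submatrix_of_pattern:
  assumes B: "B \<in> square_mats k a" and RS: "(R, S) \<in> positions n k"
    and f: "\<And>p q. p \<in> R \<Longrightarrow> q \<in> S \<Longrightarrow> f (p, q) = pattern B (R, S) (p, q)"
  shows "is_submatrix B (Matrix.mat n n f)"
proof -
  have R: "R \<subseteq> {..<n}" "card R = k" and S: "S \<subseteq> {..<n}" "card S = k"
    using RS by (auto simp: positions_def)
  have eq: "{i. i < n \<and> i \<in> R} = R" "{j. j < n \<and> j \<in> S} = S" using R S by auto
  have c: "B \<in> carrier_mat k k" using B by (simp add: square_mats_def)
  have "B = submatrix (Matrix.mat n n f) R S"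
  proof (rule eq_matI)
    fix i j assume "i < dim_row (submatrix (Matrix.mat n n f) R S)" "j < dim_col (submatrix (Matrix.mat n n f) R S)"
    then have ij: "i < k" "j < k" by (simp_all add: dim_submatrix eq R S)
    have in_RS: "pick R i \<in> R" "pick S j \<in> S"
      using ij R S by (auto intro!: pick_in_set_le)
    have "submatrix (Matrix.mat n n f) R S $$ (i, j) = Matrix.mat n n f $$ (pick R i, pick S j)"
      using ij by (intro submatrix_index) (simp_all add: eq R S)
    also have "\<dots> = f (pick R i, pick S j)" using in_RS R S by (intro index_mat) auto
    also have "\<dots> = B $$ (i, j)"
      using f[OF in_RS] ij R S by (simp add: pattern_def card_pick_le)
    finally show "B $$ (i, j) = submatrix (Matrix.mat n n f) R S $$ (i, j)" by simp
  qed (use c in \<open>simp_all add: dim_submatrix eq R S\<close>)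
  then show ?thesis unfolding is_submatrix_def using R S by auto
qed

section \<open>Existence of small omnimosaics\<close>

text \<open>For each \<open>B\<close>, the cells and entries prescribed by placing \<open>B\<close> at every position form a
  \<open>pattern_family\<close>, so few fillings miss \<open>B\<close>; the sets of bad fillings for all \<open>B\<close> together do not
  exhaust the fillings.\<close>

lemma omnimosaic_of_union_bound:
  assumes a: "a \<ge> 1"
    and overlap: "(\<Sum>(x, y) \<in> {..<k} \<times> {..<k} - {(0, 0)}.
      real ((k choose x) * (n choose x)) * real ((k choose y) * (n choose y))
      * real a ^ ((k - x) * (k - y)) / real a ^ (k * k)) \<le> 1/4"
    and small: "real a ^ (k * k) * (1 - 1 / real a ^ (k * k) / 2) ^ ((n choose k) * (n choose k)) < 1"
  shows "\<exists>M. omnimosaic n k a M"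
proof -
  let ?C = "{..<n} \<times> {..<n}" and ?U = "\<lambda>(R, S). R \<times> S :: (nat \<times> nat) set"
  let ?\<Omega> = "?C \<rightarrow>\<^sub>E {1..a}"
  define bad where "bad B = {f \<in> ?\<Omega>. \<forall>i\<in>positions n k. \<exists>z\<in>?U i. f z \<noteq> pattern B i z}" for B
  let ?P = "(1 - 1 / real a ^ (k * k) / 2) ^ ((n choose k) * (n choose k))"
  have bad_le: "real (card (bad B)) \<le> ?P * real (card ?\<Omega>)" if B: "B \<in> square_mats k a" for B
  proof -
    interpret pattern_family ?C "{1..a}" "positions n k" ?U "pattern B" "k * k"
    proof
      show "(\<Sum>j | j \<in> positions n k \<and> j \<noteq> i \<and> ?U i \<inter> ?U j \<noteq> {}.
          real (card {1..a}) ^ card (?U i \<inter> ?U j) / real (card {1..a}) ^ (k * k)) \<le> 1/4"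
        if "i \<in> positions n k" for i
        using order_trans[OF position_overlap_sum_le[OF _ that, of "real a"] overlap] by simp
    qed (use a finite_positions pattern_in[OF B] in \<open>auto simp: positions_def card_cartesian_product\<close>)
    have "avoid (positions n k) = bad B"
      unfolding avoid_def occ_def bad_def by auto
    then show ?thesis using card_avoid_le unfolding occ_prob_def
      by (simp add: card_positions card_PiE)
  qed
  have fin: "finite ?\<Omega>" by (intro finite_PiE) auto
  have "?\<Omega> \<noteq> {}" using a by (auto simp: PiE_eq_empty_iff)
  then have pos: "real (card ?\<Omega>) > 0" using fin by (simp add: card_gt_0_iff)
  have "real (card (\<Union>B\<in>square_mats k a. bad B)) \<le> (\<Sum>B\<in>square_mats k a. real (card (bad B)))"
    using card_UN_le[OF finite_square_mats, of bad k a] by (simp flip: of_nat_sum)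
  also have "\<dots> \<le> (\<Sum>B\<in>square_mats k a. ?P * real (card ?\<Omega>))" using bad_le by (rule sum_mono)
  also have "\<dots> = real (card (square_mats k a)) * (?P * real (card ?\<Omega>))" by simp
  also have "\<dots> \<le> real (a ^ (k * k)) * (?P * real (card ?\<Omega>))"
  proof (intro mult_right_mono of_nat_mono card_square_mats_le mult_nonneg_nonneg zero_le_power)
    have "0 \<le> 1 - 1 / q / 2" if "1 \<le> q" for q :: real using that by (simp add: field_simps)
    then show "0 \<le> 1 - 1 / real a ^ (k * k) / 2" using a by (simp only: one_le_power real_of_nat_ge_one_iff)
  qed simp
  also have "\<dots> = (real a ^ (k * k) * ?P) * real (card ?\<Omega>)" by simp
  also have "\<dots> < 1 * real (card ?\<Omega>)" using small pos by (rule mult_strict_right_mono)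
  finally have "card (\<Union>B\<in>square_mats k a. bad B) < card ?\<Omega>" by simp
  then obtain f where f: "f \<in> ?\<Omega>" "f \<notin> (\<Union>B\<in>square_mats k a. bad B)"
    using card_mono[of "\<Union>B\<in>square_mats k a. bad B" ?\<Omega>] finite_square_mats
      finite_subset[of "bad _" ?\<Omega>] fin
    by (metis (no_types, lifting) bad_def finite_UN mem_Collect_eq not_le subsetI)
  have "Matrix.mat n n f \<in> square_mats n a"
    using f(1) by (auto simp: square_mats_def elements_mat_def)
  moreover have "is_submatrix B (Matrix.mat n n f)" if B: "B \<in> square_mats k a" for B
  proof -
    obtain R S where "(R, S) \<in> positions n k" "\<forall>z\<in>R \<times> S. f z = pattern B (R, S) z"
      using f B by (auto simp: bad_def)
    then show ?thesis using B by (intro submatrix_of_pattern) auto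
  qed
  ultimately show ?thesis unfolding omnimosaic_def by blast
qed

theorem theorem3p1:
  fixes a :: nat
  assumes "a \<ge> 2"
  shows "(\<lambda>k::nat. 2 * ln (real k) / real k) \<in> o(\<lambda>_. 1) \<and>
    (\<forall>\<^sub>F k::nat in sequentially.
       real (omega k a) \<le>
         real k * real a powr (real k / 2) / exp 1 * (1 + 2 * ln (real k) / real k))"
proof (rule conjI)
  show "(\<lambda>k::nat. 2 * ln (real k) / real k) \<in> o(\<lambda>_. 1)" by real_asymp
  show "\<forall>\<^sub>F k::nat in sequentially.
       real (omega k a) \<le>
         real k * real a powr (real k / 2) / exp 1 * (1 + 2 * ln (real k) / real k)"
    using eventually_ge_at_top[of 3] eventually_copies_base_pos eventually_copies_exceed[of "ln (real a)"]
      eventually_overlap_weight_small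
  proof eventually_elim
    case (elim k)
    define b where "b = real k * real a powr (real k / 2) / exp 1 * (1 + 2 * ln (real k) / real k)"
    define n where "n = nat \<lfloor>b\<rfloor>"
    have "b \<ge> 0" using elim(1) by (auto simp: b_def intro!: mult_nonneg_nonneg add_nonneg_nonneg)
    then have n: "real n \<le> b" "b - 1 \<le> real n" unfolding n_def by linarith+
    have "real a powr (- real k / 8) \<le> 2 powr (- real k / 8)"
      using assms by (intro powr_mono2') auto
    then have "real k ^ 8 * real a powr (- real k / 8) \<le> real k ^ 8 * 2 powr (- real k / 8)"
      by (intro mult_left_mono) auto
    then have q: "real k ^ 8 * real a powr (- real k / 8) \<le> 1/4" using elim(4) by linarith
    have "\<exists>M. omnimosaic n k a M"
    proof (rule omnimosaic_of_union_bound)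
      show "(\<Sum>(x, y) \<in> {..<k} \<times> {..<k} - {(0, 0)}.
          real ((k choose x) * (n choose x)) * real ((k choose y) * (n choose y))
          * real a ^ ((k - x) * (k - y)) / real a ^ (k * k)) \<le> 1/4"
        using assms elim(1) n(1) q by (intro overlap_sum_le) (auto simp: b_def)
      show "real a ^ (k * k) * (1 - 1 / real a ^ (k * k) / 2) ^ ((n choose k) * (n choose k)) < 1"
        using assms elim(1) n(2) elim(2,3) by (intro copies_beat_union_bound) (auto simp: b_def)
    qed (use assms in auto)
    then have "omega k a \<le> n" unfolding omega_def by (rule Least_le)
    then show ?case using n(1) unfolding b_def by linarith
  qed
qed

end
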